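(* Let $q$ be an integer and let $G$ be a graph on $m$ vertices with \[ q>|N^2(v)| + 2|N(v)| \] for all vertices $v$ of $G$. Then $G \square K_q$ is $\mathtt{VD}_{m}$.
   Context: Graphs are finite and simple. $N(v)$ is the set of vertices adjacent to $v$ in $G$, and $N^2(v)$ is the set of vertices at distance two from $v$ in $G$. For a vertex $v$ of a graph $H$, $N^\bullet_H(v)$ denotes the set consisting of $v$ and all vertices adjacent to $v$ in $H$; $H\setminus S$ is the graph obtained by deleting the vertices in $S$. $K_q$ is the complete graph on $q$ vertices. The cartesian product $G\square H$ is the graph with vertex set $V(G)\times V(H)$ and edge set \[ \{ (u,v)(u',v) \mid uu' \in E(G),\ v\in V(H) \} \cup \{ (u,v)(u,v') \mid u \in V(G),\ vv'\in E(H) \}. \] For non-negative integers $k$ the graph property $\mathtt{VD}_k$ is defined recursively (as the smallest family of properties closed under the following rules): any graph is $\mathtt{VD}_0$; a graph on $k$ vertices with no edges is $\mathtt{VD}_k$; if $k\ge 1$ and a graph $H$ has a vertex $v$ such that $H\setminus v$ is $\mathtt{VD}_k$ and $H\setminus N^\bullet_H(v)$ is $\mathtt{VD}_{k-1}$, then $H$ is $\mathtt{VD}_k$. *)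

theory Defs
  imports "Graph_Theory.Graph_Theory"
begin

text \<open>
  A finite simple graph is an instance of the locale \<^locale>\<open>graph\<close> (finite, loopfree, no parallel
  arcs, symmetric); the null graph is allowed. An undirected edge is the pair of its two arcs.
\<close>

definition nbhd :: "('a, 'b) pre_digraph \<Rightarrow> 'a \<Rightarrow> 'a set" where
  "nbhd G v = {u \<in> verts G. v \<rightarrow>\<^bsub>G\<^esub> u}"

definition closed_nbhd :: "('a, 'b) pre_digraph \<Rightarrow> 'a \<Rightarrow> 'a set" where
  "closed_nbhd G v = insert v (nbhd G v)"

text \<open>With every arc of cost 1, \<^const>\<open>wf_digraph.\<mu>\<close> is the usual distance (infinite between
  different components).\<close>

definition nbhd2 :: "('a, 'b) pre_digraph \<Rightarrow> 'a \<Rightarrow> 'a set" where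
  "nbhd2 G v = {u \<in> verts G. wf_digraph.\<mu> G (\<lambda>_. 1) v u = 2}"

definition delete_verts :: "('a, 'b) pre_digraph \<Rightarrow> 'a set \<Rightarrow> ('a, 'b) pre_digraph" where
  "delete_verts H S = H \<restriction> (verts H - S)"

definition cartesian_product ::
    "('a, 'b) pre_digraph \<Rightarrow> ('c, 'd) pre_digraph \<Rightarrow> ('a \<times> 'c, ('a \<times> 'c) \<times> ('a \<times> 'c)) pre_digraph"
    (infixl \<open>\<box>\<close> 68) where
  "G \<box> H = with_proj
     \<lparr> pverts = verts G \<times> verts H,
       parcs = {((u, v), (u', v)) | u u' v. u \<rightarrow>\<^bsub>G\<^esub> u' \<and> v \<in> verts H}
             \<union> {((u, v), (u, v')) | u v v'. u \<in> verts G \<and> v \<rightarrow>\<^bsub>H\<^esub> v'} \<rparr>"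

inductive VD :: "nat \<Rightarrow> ('a, 'b) pre_digraph \<Rightarrow> bool" where
  VD_0: "graph H \<Longrightarrow> VD 0 H"
| VD_edgeless: "\<lbrakk>graph H; card (verts H) = k; arcs H = {}\<rbrakk> \<Longrightarrow> VD k H"
| VD_step: "\<lbrakk>graph H; k \<ge> 1; v \<in> verts H;
      VD k (delete_verts H {v}); VD (k - 1) (delete_verts H (closed_nbhd H v))\<rbrakk> \<Longrightarrow> VD k H"

end

theory Submission
  imports Defs
begin

text \<open>
  Independent sets of \<open>G \<box> K\<^sub>q\<close> are partial proper colourings of \<open>G\<close>, and the induced subgraphs of
  \<open>G \<box> K\<^sub>q\<close> correspond to colourings from lists. The statement is generalised to lists in which every
  remaining vertex \<open>u\<close> has more than \<open>|N\<^sup>2(u)| + 2|N(u)|\<close> colours, the neighbourhoods being restricted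
  to the remaining vertices, and is proved by induction on their number. Pick a vertex \<open>v\<close> and a colour
  \<open>c\<close> in its list. Shed the pairs \<open>(w, c)\<close> with \<open>w\<close> adjacent to \<open>v\<close>, then the pairs \<open>(v, c')\<close> with
  \<open>c' \<noteq> c\<close>; in each link one vertex of \<open>G\<close> has disappeared, its neighbours have lost at most two colours
  and the vertices at distance two from it at most one. Finally \<open>(v, c)\<close> is isolated, and
  adding an isolated vertex to a graph raises the index of \<open>VD\<close> by one.
\<close>

section \<open>Vertex deletion and induced subgraphs\<close>

lemma verts_delete_verts [simp]: "verts (delete_verts H S) = verts H - S"
  by (simp add: delete_verts_def)

lemma delete_verts_cong:
  "verts H \<inter> S = verts H \<inter> T \<Longrightarrow> delete_verts H S = delete_verts H T"
proof -
  assume "verts H \<inter> S = verts H \<inter> T"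
  then have "verts H - S = verts H - T" by auto
  then show ?thesis by (simp add: delete_verts_def)
qed

lemma delete_verts_delete_verts:
  "delete_verts (delete_verts H S) T = delete_verts H (S \<union> T)"
  by (auto simp: delete_verts_def induce_subgraph_def)

lemma delete_verts_induce_subgraph: "delete_verts (H \<restriction> S) T = H \<restriction> (S - T)"
  by (auto simp: delete_verts_def induce_subgraph_def)

lemma (in wf_digraph) induce_subgraph_self: "G \<restriction> verts G = G"
  by (rule pre_digraph.equality) auto

lemma graph_induce_subgraph:
  assumes "graph H" "S \<subseteq> verts H"
  shows "graph (H \<restriction> S)"
proof -
  interpret graph H by fact
  have "induced_subgraph (H \<restriction> S) H" by (rule induced_induce) fact
  then interpret h: digraph "H \<restriction> S" by (rule digraphI_induced)
  show ?thesis
    using induced_graph_imp_symmetric[OF sym_arcs \<open>induced_subgraph (H \<restriction> S) H\<close>] by (rule h.graphI)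
qed

lemma graph_delete_verts: "graph H \<Longrightarrow> graph (delete_verts H S)"
  by (simp add: delete_verts_def graph_induce_subgraph)

lemma dominates_induce_subgraph:
  "u \<rightarrow>\<^bsub>H \<restriction> S\<^esub> v \<longleftrightarrow> u \<in> S \<and> v \<in> S \<and> u \<rightarrow>\<^bsub>H\<^esub> v"
  by (auto simp: arcs_ends_conv)

lemma nbhd_delete_verts:
  "v \<in> verts H - S \<Longrightarrow> nbhd (delete_verts H S) v = nbhd H v - S"
  by (auto simp: delete_verts_def nbhd_def dominates_induce_subgraph)

lemma closed_nbhd_delete_verts:
  "v \<in> verts H - S \<Longrightarrow> closed_nbhd (delete_verts H S) v = closed_nbhd H v - S"
  by (auto simp: closed_nbhd_def nbhd_delete_verts)

lemma (in sym_digraph) nbhd_sym: "v \<in> verts G \<Longrightarrow> u \<in> nbhd G v \<Longrightarrow> v \<in> nbhd G u"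
  using arcs_ends_symmetric[OF sym_arcs] by (auto simp: nbhd_def)

section \<open>Closure properties of \<open>VD\<close>\<close>

text \<open>Any vertex can be shed until a single one remains, because every link only has to be
  \<open>VD 0\<close>. This is the base case of \<open>VD_isolated\<close>.\<close>

lemma VD_1:
  assumes "graph H" "verts H \<noteq> {}"
  shows "VD 1 H"
  using assms
proof (induction "card (verts H)" arbitrary: H)
  case 0
  then interpret graph H by simp
  show ?case using 0 by simp
next
  case (Suc n)
  interpret graph H by fact
  obtain v where v: "v \<in> verts H" using Suc.prems by auto
  show ?case
  proof (cases "n = 0")
    case True
    with Suc have "verts H = {v}" using v by (metis One_nat_def card_1_singletonE singletonD)
    then have "arcs H = {}" using no_loops tail_in_verts head_in_verts by fastforce
    with True Suc show ?thesis by (intro VD_edgeless) auto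
  next
    case False
    have n: "card (verts H - {v}) = n" using v Suc.hyps(2) by simp
    with False have "verts H - {v} \<noteq> {}" by force
    then have "VD 1 (delete_verts H {v})"
      using n Suc.prems by (intro Suc.hyps(1) graph_delete_verts) simp_all
    moreover have "VD (1 - 1) (delete_verts H (closed_nbhd H v))"
      using Suc.prems by (simp add: VD_0 graph_delete_verts)
    ultimately show ?thesis using v Suc.prems by (auto intro: VD_step[of _ _ v])
  qed
qed

text \<open>Induction on the derivation for the graph without \<open>x\<close>: every vertex
  \<open>v\<close> shed there can be shed in \<open>H\<close> too, since \<open>x\<close> stays
  isolated both in the deletion of \<open>v\<close> and in its link.\<close>

lemma VD_isolated:
  assumes "graph H" "x \<in> verts H" "nbhd H x = {}" "VD k (delete_verts H {x})"
  shows "VD (Suc k) H"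
  using assms(4,1-3)
proof (induction k "delete_verts H {x}" arbitrary: H rule: VD.induct)
  case VD_0
  then show ?case using VD_1 by auto
next
  case (VD_edgeless k)
  interpret graph H by fact
  have "e \<notin> arcs H" for e
  proof
    assume e: "e \<in> arcs H"
    have "tail H e \<noteq> x \<and> head H e \<noteq> x"
      using e \<open>nbhd H x = {}\<close> in_arcs_imp_in_arcs_ends[OF e] arcs_ends_symmetric[OF sym_arcs]
        tail_in_verts[OF e] head_in_verts[OF e]
      by (fastforce simp: nbhd_def)
    then have "e \<in> arcs (delete_verts H {x})" using e by (simp add: delete_verts_def)
    then show False using VD_edgeless by simp
  qed
  moreover have "card (verts H) = Suc k"
    using \<open>x \<in> verts H\<close> \<open>card (verts (delete_verts H {x})) = k\<close>
    using card_Suc_Diff1[OF finite_verts] by auto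
  ultimately show ?case using \<open>graph H\<close> by (intro VD.VD_edgeless) auto
next
  case (VD_step k v)
  interpret graph H by fact
  have v: "v \<in> verts H" "v \<noteq> x" using VD_step by auto
  have x: "x \<notin> closed_nbhd H v"
    using v nbhd_sym[of v x] VD_step.prems by (auto simp: closed_nbhd_def)
  have iso: "nbhd (delete_verts H S) x = {}" if "x \<notin> S" for S
    using that VD_step.prems by (simp add: nbhd_delete_verts)
  \<comment> \<open>The induction hypotheses speak of graphs from which \<open>x\<close> is deleted
    last, so the deletions are commuted.\<close>
  have eq1: "delete_verts (delete_verts H {x}) {v} = delete_verts (delete_verts H {v}) {x}"
    by (simp add: delete_verts_delete_verts insert_commute)
  have "VD (Suc k) (delete_verts H {v})"
    using v VD_step.prems by (intro VD_step.hyps(5) eq1 graph_delete_verts iso) auto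
  \<comment> \<open>As \<open>k \<ge> 1\<close>, the index \<open>Suc (k - 1)\<close> equals
    \<open>Suc k - 1\<close>, which \<open>VD_step\<close> asks of the link.\<close>
  moreover have "VD (Suc (k - 1)) (delete_verts H (closed_nbhd H v))"
  proof -
    have eq2: "delete_verts (delete_verts H {x}) (closed_nbhd (delete_verts H {x}) v)
        = delete_verts (delete_verts H (closed_nbhd H v)) {x}"
      using v by (auto simp: delete_verts_delete_verts closed_nbhd_delete_verts intro: delete_verts_cong)
    show ?thesis
      using x VD_step.prems by (intro VD_step.hyps(7) eq2 graph_delete_verts iso) auto
  qed
  ultimately show ?case
    using VD_step.hyps(2) VD_step.prems v by (auto intro: VD.VD_step[of _ _ v])
qed

text \<open>Iterates \<open>VD_step\<close> over \<open>T\<close>. The set \<open>A\<close> stands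
  for the vertices already shed before \<open>x\<close>; it is arbitrary because the order of
  shedding is not fixed.\<close>

lemma VD_delete_set:
  assumes "finite T" "graph H" "k \<ge> 1" "T \<subseteq> verts H"
    and "\<And>A x. A \<subseteq> T \<Longrightarrow> x \<in> T - A \<Longrightarrow> VD (k - 1) (delete_verts H (A \<union> closed_nbhd H x))"
    and "VD k (delete_verts H T)"
  shows "VD k H"
  using assms
proof (induction T arbitrary: H rule: finite_induct)
  case empty
  interpret graph H by fact
  show ?case using empty by (simp add: delete_verts_def induce_subgraph_self)
next
  case (insert x T)
  have "VD k (delete_verts H {x})"
  proof (rule insert.IH)
    fix A y assume A: "A \<subseteq> T" "y \<in> T - A"
    then have "y \<in> verts H - {x}" using insert by auto
    then have "delete_verts (delete_verts H {x}) (A \<union> closed_nbhd (delete_verts H {x}) y)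
        = delete_verts H (insert x A \<union> closed_nbhd H y)"
      by (auto simp: delete_verts_delete_verts closed_nbhd_delete_verts intro: delete_verts_cong)
    moreover have "VD (k - 1) (delete_verts H (insert x A \<union> closed_nbhd H y))"
      using A insert by (intro insert.prems(4)) auto
    ultimately show "VD (k - 1) (delete_verts (delete_verts H {x})
        (A \<union> closed_nbhd (delete_verts H {x}) y))" by simp
  qed (use insert in \<open>auto simp: delete_verts_delete_verts graph_delete_verts\<close>)
  moreover have "VD (k - 1) (delete_verts H (closed_nbhd H x))"
    using insert.prems(4)[of "{}" x] by simp
  ultimately show ?case using insert.prems by (auto intro: VD_step[of _ _ x])
qed

section \<open>Distance two\<close>

text \<open>The path through \<open>v\<close> bounds the distance above by 2, and a walk from
  \<open>u\<close> to \<open>w\<close> of length 0 or 1 is excluded by the last two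
  hypotheses.\<close>

lemma (in graph) nbhd2I:
  assumes "v \<in> nbhd G u" "w \<in> nbhd G v" "w \<notin> nbhd G u" "w \<noteq> u"
  shows "w \<in> nbhd2 G u"
proof -
  obtain e1 e2 where e: "e1 \<in> arcs G" "tail G e1 = u" "head G e1 = v"
    "e2 \<in> arcs G" "tail G e2 = v" "head G e2 = w"
    using assms by (auto simp: nbhd_def arcs_ends_conv)
  have w: "w \<in> verts G" using assms by (simp add: nbhd_def)
  have "\<mu> (\<lambda>_. 1) u w \<le> awalk_cost (\<lambda>_. 1) [e1, e2]"
    by (rule min_cost_le_walk_cost) (use e in \<open>auto simp: awalk_def\<close>)
  moreover have "2 \<le> ereal (awalk_cost (\<lambda>_. 1) p)" if p: "awalk u p w" for p
  proof -
    have "length p \<noteq> 0" using p assms by (auto simp: awalk_Nil_iff)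
    moreover have "length p \<noteq> Suc 0"
    proof
      assume "length p = Suc 0"
      then obtain e where "p = [e]" by (metis length_0_conv length_Suc_conv)
      with p have "u \<rightarrow>\<^bsub>G\<^esub> w"
        by (auto simp: awalk_Cons_iff awalk_Nil_iff in_arcs_imp_in_arcs_ends)
      then show False using assms w by (simp add: nbhd_def)
    qed
    moreover have "awalk_cost (\<lambda>_. 1) p = real (length p)" by (induction p) auto
    ultimately have "2 \<le> awalk_cost (\<lambda>_. 1) p" by linarith
    then show ?thesis by simp
  qed
  then have "2 \<le> \<mu> (\<lambda>_. 1) u w" unfolding \<mu>_def by (auto intro: INF_greatest)
  ultimately show ?thesis using w by (simp add: nbhd2_def)
qed

section \<open>Cartesian products\<close>

lemma dominates_cartesian_product:
  "(u, c) \<rightarrow>\<^bsub>G \<box> H\<^esub> (v, d) \<longleftrightarrow>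
    u \<rightarrow>\<^bsub>G\<^esub> v \<and> c = d \<and> c \<in> verts H \<or> u = v \<and> u \<in> verts G \<and> c \<rightarrow>\<^bsub>H\<^esub> d"
  by (auto simp: cartesian_product_def)

lemma verts_cartesian_product [simp]: "verts (G \<box> H) = verts G \<times> verts H"
  by (simp add: cartesian_product_def)

lemma graph_cartesian_product:
  assumes "graph G" "graph H"
  shows "graph (G \<box> H)"
proof -
  interpret G: graph G by fact
  interpret H: graph H by fact
  let ?P = "\<lparr> pverts = verts G \<times> verts H,
       parcs = {((u, v), (u', v)) | u u' v. u \<rightarrow>\<^bsub>G\<^esub> u' \<and> v \<in> verts H}
             \<union> {((u, v), (u, v')) | u v v'. u \<in> verts G \<and> v \<rightarrow>\<^bsub>H\<^esub> v'} \<rparr>"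
  have sub: "parcs ?P \<subseteq> (verts G \<times> verts H) \<times> (verts G \<times> verts H)"
    using G.adj_in_verts H.adj_in_verts by auto
  have fin: "finite (parcs ?P)"
    by (rule finite_subset[OF sub]) simp
  have sym: "sym (parcs ?P)"
    using arcs_ends_symmetric[OF G.sym_arcs] arcs_ends_symmetric[OF H.sym_arcs]
    by (auto simp: sym_def)
  have loop: "fst e \<noteq> snd e" if "e \<in> parcs ?P" for e
    using that G.adj_not_same H.adj_not_same by auto
  interpret pair_graph ?P
  proof unfold_locales
    show "fst e \<in> pverts ?P" "snd e \<in> pverts ?P" if "e \<in> parcs ?P" for e
      using that sub by auto
    show "symmetric (with_proj ?P)" using sym by (simp only: symmetric_def with_proj_simps)
  qed (use fin loop in simp_all)
  show ?thesis unfolding cartesian_product_def by unfold_locales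
qed

text \<open>
  The set \<open>S\<close> encodes the lists: the colours available at \<open>u\<close> are \<open>S `` {u}\<close>.
\<close>

lemma VD_list_product:
  assumes G: "graph G" and K: "complete_digraph n K"
    and W: "W \<subseteq> verts G" and S: "S \<subseteq> W \<times> verts K"
    and large: "\<And>u. u \<in> W \<Longrightarrow>
      card (nbhd2 G u \<inter> W) + 2 * card (nbhd G u \<inter> W) < card (S `` {u})"
  shows "VD (card W) ((G \<box> K) \<restriction> S)"
proof -
  interpret G: graph G by fact
  interpret K: graph K using K by (simp add: complete_digraph_def)
  have K_adj: "c \<rightarrow>\<^bsub>K\<^esub> d \<longleftrightarrow> c \<in> verts K \<and> d \<in> verts K \<and> c \<noteq> d" for c d
    using K by (auto simp: complete_digraph_def)
  let ?P = "G \<box> K"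
  have P: "graph ?P" by (intro graph_cartesian_product G.graph_axioms K.graph_axioms)
  have finW: "finite W'" if "W' \<subseteq> verts G" for W'
    using that by (rule finite_subset) simp
  \<comment> \<open>This \<open>S\<close> is arbitrary and shadows that of the lemma: the fact is
    applied to \<open>S\<close>, \<open>S - T1\<close> and \<open>S - T1 - T2\<close>.\<close>
  have nbhd_P: "nbhd (?P \<restriction> S) (v, c)
      = {(u, d) \<in> S. u \<in> nbhd G v \<and> d = c \<or> u = v \<and> d \<noteq> c}"
    if "(v, c) \<in> S" "S \<subseteq> verts ?P" for v c S
    using that by (auto simp: nbhd_def dominates_induce_subgraph dominates_cartesian_product K_adj)
  show ?thesis
    using W S large
  proof (induction "card W" arbitrary: W S)
    case 0
    have "S \<subseteq> verts ?P" using 0 by auto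
    then have "graph (?P \<restriction> S)" using P graph_induce_subgraph by blast
    then show ?case using 0 VD_0 by metis
  next
    case (Suc k)
    \<comment> \<open>The induction hypothesis in the form needed for links: \<open>w\<close>
      disappears and \<open>R\<close> holds the colours lost at \<open>u\<close>. Removing
      \<open>w\<close> lowers the required list size at \<open>u\<close> by 1 if \<open>w\<close> is
      at distance two and by 2 if it is adjacent, so the strict bound survives.\<close>
    have step: "VD k (?P \<restriction> S')"
      if w: "w \<in> W" and S': "S' \<subseteq> (W - {w}) \<times> verts K"
        and lost: "\<And>u. u \<in> W - {w} \<Longrightarrow> \<exists>R. S `` {u} \<subseteq> S' `` {u} \<union> R \<and> finite R \<and>
          card R \<le> (if w \<in> nbhd2 G u then 1 else 0) + 2 * (if w \<in> nbhd G u then 1 else 0)"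
      for w S'
    proof -
      have k: "card (W - {w}) = k" using Suc.hyps(2) w by simp
      have "VD (card (W - {w})) (?P \<restriction> S')"
      proof (rule Suc.hyps(1))
        fix u assume u: "u \<in> W - {w}"
        obtain R where R: "S `` {u} \<subseteq> S' `` {u} \<union> R" "finite R"
          "card R \<le> (if w \<in> nbhd2 G u then 1 else 0) + 2 * (if w \<in> nbhd G u then 1 else 0)"
          using lost[OF u] by blast
        have "finite (S' `` {u})"
          by (rule finite_subset[of _ "verts K"]) (use S' in auto)
        then have "card (S `` {u}) \<le> card (S' `` {u}) + card R"
          using R card_mono[OF _ R(1)] card_Un_le[of "S' `` {u}" R] by fastforce
        moreover have rest: "card (X \<inter> W) = card (X \<inter> (W - {w})) + (if w \<in> X then 1 else 0)" for X
        proof (cases "w \<in> X")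
          case True
          then have "X \<inter> W = insert w (X \<inter> (W - {w}))" using w by auto
          with True show ?thesis using finW[OF Suc.prems(1)] by simp
        next
          case False
          then have "X \<inter> W = X \<inter> (W - {w})" by auto
          with False show ?thesis by simp
        qed
        ultimately show "card (nbhd2 G u \<inter> (W - {w})) + 2 * card (nbhd G u \<inter> (W - {w}))
            < card (S' `` {u})"
          using Suc.prems(3)[of u] u R(3) rest[of "nbhd G u"] rest[of "nbhd2 G u"] by auto
      qed (use k Suc.prems S' in auto)
      with k show ?thesis by simp
    qed
    obtain v where v: "v \<in> W" using Suc.hyps(2) by (metis card.empty ex_in_conv nat.distinct(1))
    have "S `` {v} \<noteq> {}" using Suc.prems(3)[OF v] by auto
    then obtain c where c: "(v, c) \<in> S" by auto
    \<comment> \<open>\<open>T1\<close> and \<open>T2\<close> together are the neighbours of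
      \<open>(v, c)\<close> within \<open>S\<close>.\<close>
    define T1 where "T1 = {(w, d) \<in> S. w \<in> nbhd G v \<and> d = c}"
    define T2 where "T2 = {(w, d) \<in> S. w = v \<and> d \<noteq> c}"
    have vG: "v \<in> verts G" using v Suc.prems by auto
    have v_nbhd: "v \<notin> nbhd G v" using G.adj_not_same by (auto simp: nbhd_def)
    have SP: "S \<subseteq> verts ?P" using Suc.prems by auto
    have finS: "finite S"
      using SP by (rule finite_subset) simp
    have sym: "x \<in> nbhd G y" if "y \<in> nbhd G x" "x \<in> verts G" for x y
      using that by (rule G.nbhd_sym[rotated])
    have gr: "graph (?P \<restriction> S')" if "S' \<subseteq> S" for S'
      using that SP P by (intro graph_induce_subgraph) auto
    have "VD (Suc k) (?P \<restriction> (S - T1))"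
    proof (rule VD_delete_set[of T2])
      fix A x assume A: "A \<subseteq> T2" and "x \<in> T2 - A"
      then obtain c' where x: "x = (v, c')" "(v, c') \<in> S" "c' \<noteq> c" by (auto simp: T2_def)
      have x1: "(v, c') \<in> S - T1" "S - T1 \<subseteq> verts ?P" using x v_nbhd SP by (auto simp: T1_def)
      have "VD k (?P \<restriction> (S - T1 - (A \<union> closed_nbhd (?P \<restriction> (S - T1)) x)))"
      proof (rule step[OF v])
        show "S - T1 - (A \<union> closed_nbhd (?P \<restriction> (S - T1)) x) \<subseteq> (W - {v}) \<times> verts K"
          using Suc.prems unfolding x(1) closed_nbhd_def nbhd_P[OF x1] by auto
        fix u assume u: "u \<in> W - {v}"
        show "\<exists>R. S `` {u} \<subseteq> (S - T1 - (A \<union> closed_nbhd (?P \<restriction> (S - T1)) x)) `` {u} \<union> R \<and> finite R \<and>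
          card R \<le> (if v \<in> nbhd2 G u then 1 else 0) + 2 * (if v \<in> nbhd G u then 1 else 0)"
        \<comment> \<open>A neighbour of \<open>v\<close> has lost \<open>c\<close> with
          \<open>T1\<close> and loses \<open>c'\<close> in the link; this is where the factor 2 is
          needed.\<close>
        proof (rule exI[of _ "if u \<in> nbhd G v then {c, c'} else {}"], intro conjI)
          show "S `` {u} \<subseteq> (S - T1 - (A \<union> closed_nbhd (?P \<restriction> (S - T1)) x)) `` {u} \<union>
              (if u \<in> nbhd G v then {c, c'} else {})"
            using u A unfolding x(1) closed_nbhd_def nbhd_P[OF x1] by (auto simp: T1_def T2_def)
        qed (use sym[of u v] vG in \<open>auto simp: card_insert_if\<close>)
      qed
      then show "VD (Suc k - 1) (delete_verts (?P \<restriction> (S - T1)) (A \<union> closed_nbhd (?P \<restriction> (S - T1)) x))"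
        by (simp add: delete_verts_induce_subgraph)
    next
      let ?S = "S - T1 - T2"
      have c2: "(v, c) \<in> ?S" using c v_nbhd by (auto simp: T1_def T2_def)
      have "?S \<subseteq> verts ?P" using SP by auto
      then have iso: "nbhd (?P \<restriction> ?S) (v, c) = {}"
        using nbhd_P[OF c2] by (auto simp: T1_def T2_def)
      \<comment> \<open>No pair over \<open>v\<close> remains, so the induction hypothesis yields
        index \<open>k\<close>; restoring the isolated \<open>(v, c)\<close> adds the missing
        one.\<close>
      have "VD k (?P \<restriction> (?S - {(v, c)}))"
      proof (rule step[OF v])
        show "?S - {(v, c)} \<subseteq> (W - {v}) \<times> verts K"
          using Suc.prems by (auto simp: T2_def)
        fix u assume u: "u \<in> W - {v}"
        show "\<exists>R. S `` {u} \<subseteq> (?S - {(v, c)}) `` {u} \<union> R \<and> finite R \<and>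
          card R \<le> (if v \<in> nbhd2 G u then 1 else 0) + 2 * (if v \<in> nbhd G u then 1 else 0)"
        proof (rule exI[of _ "if u \<in> nbhd G v then {c} else {}"], intro conjI)
          show "S `` {u} \<subseteq> (?S - {(v, c)}) `` {u} \<union> (if u \<in> nbhd G v then {c} else {})"
            using u by (auto simp: T1_def T2_def)
        qed (use sym[of u v] vG in auto)
      qed
      then show "VD (Suc k) (delete_verts (?P \<restriction> (S - T1)) T2)"
        using c2 iso gr[of ?S]
        by (auto simp: delete_verts_induce_subgraph intro!: VD_isolated[of _ "(v, c)"])
    next
      show "T2 \<subseteq> verts (?P \<restriction> (S - T1))" using v_nbhd by (auto simp: T1_def T2_def)
      then show "finite T2" using finS by (auto intro: finite_subset)
    qed (use gr in auto)
    then have "VD (Suc k) (?P \<restriction> S)"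
    proof (intro VD_delete_set[of T1 "?P \<restriction> S"])
      fix A x assume A: "A \<subseteq> T1" and "x \<in> T1 - A"
      then obtain w where x: "x = (w, c)" "(w, c) \<in> S" "w \<in> nbhd G v" by (auto simp: T1_def)
      have w: "w \<in> W" using x Suc.prems by auto
      have "VD k (?P \<restriction> (S - (A \<union> closed_nbhd (?P \<restriction> S) x)))"
      proof (rule step[OF w])
        show "S - (A \<union> closed_nbhd (?P \<restriction> S) x) \<subseteq> (W - {w}) \<times> verts K"
          using Suc.prems unfolding x(1) closed_nbhd_def nbhd_P[OF x(2) SP] by auto
        fix u assume u: "u \<in> W - {w}"
        \<comment> \<open>A vertex \<open>u\<close> adjacent to \<open>v\<close> shares that
          neighbour with \<open>w\<close>, so \<open>u\<close> and \<open>w\<close> are adjacent or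
          at distance two. All of \<open>T1\<close> has colour \<open>c\<close>, so \<open>u\<close>
          loses at most this one colour.\<close>
        have near: "w \<in> nbhd G u \<or> w \<in> nbhd2 G u" if "u \<in> nbhd G v \<or> u \<in> nbhd G w"
          using that G.nbhd2I[of v u w] sym[of u v] sym[of u w] vG x w u Suc.prems(1) by blast
        show "\<exists>R. S `` {u} \<subseteq> (S - (A \<union> closed_nbhd (?P \<restriction> S) x)) `` {u} \<union> R \<and> finite R \<and>
          card R \<le> (if w \<in> nbhd2 G u then 1 else 0) + 2 * (if w \<in> nbhd G u then 1 else 0)"
        proof (rule exI[of _ "if u \<in> nbhd G v \<or> u \<in> nbhd G w then {c} else {}"], intro conjI)
          show "S `` {u} \<subseteq> (S - (A \<union> closed_nbhd (?P \<restriction> S) x)) `` {u} \<union>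
              (if u \<in> nbhd G v \<or> u \<in> nbhd G w then {c} else {})"
            using u A unfolding x(1) closed_nbhd_def nbhd_P[OF x(2) SP] by (auto simp: T1_def)
        qed (use near in auto)
      qed
      then show "VD (Suc k - 1) (delete_verts (?P \<restriction> S) (A \<union> closed_nbhd (?P \<restriction> S) x))"
        by (simp add: delete_verts_induce_subgraph)
    next
      show "finite T1" using finS by (auto intro: finite_subset simp: T1_def)
    qed (use gr in \<open>auto simp: delete_verts_induce_subgraph T1_def\<close>)
    then show ?case using Suc.hyps(2) by simp
  qed
qed

theorem corollary2p14:
  fixes q :: int and m :: nat
    and G :: "('a, 'b) pre_digraph" and Kq :: "('c, 'd) pre_digraph"
  assumes "graph G" and "card (verts G) = m"
    and "complete_digraph (nat q) Kq"
    and "\<And>v. v \<in> verts G \<Longrightarrow> q > int (card (nbhd2 G v)) + 2 * int (card (nbhd G v))"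
  shows "VD m (G \<box> Kq)"
proof -
  \<comment> \<open>If \<open>G\<close> has a vertex, the hypothesis forces \<open>q > 0\<close>, so
    \<open>nat q\<close> is then \<open>q\<close> itself.\<close>
  have K: "graph Kq" "card (verts Kq) = nat q" using assms(3) by (auto simp: complete_digraph_def)
  interpret P: graph "G \<box> Kq" using assms(1) K(1) by (rule graph_cartesian_product)
  \<comment> \<open>All vertices remain and each has the full list \<open>verts Kq\<close>.\<close>
  have "VD (card (verts G)) ((G \<box> Kq) \<restriction> (verts G \<times> verts Kq))"
  proof (rule VD_list_product[OF assms(1,3)])
    fix u assume u: "u \<in> verts G"
    have "nbhd G u \<inter> verts G = nbhd G u" "nbhd2 G u \<inter> verts G = nbhd2 G u"
      "(verts G \<times> verts Kq) `` {u} = verts Kq"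
      using u by (auto simp: nbhd_def nbhd2_def)
    then show "card (nbhd2 G u \<inter> verts G) + 2 * card (nbhd G u \<inter> verts G)
        < card ((verts G \<times> verts Kq) `` {u})"
      using assms(4)[OF u] K(2) by simp
  qed auto
  moreover have "(G \<box> Kq) \<restriction> (verts G \<times> verts Kq) = G \<box> Kq"
    using P.induce_subgraph_self by simp
  ultimately show ?thesis using assms(2) by simp
qed

end
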